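(* Let $X,Y$ be metric spaces, and let $F:X\rightrightarrows Y$, $(\bar x,\bar y)\in\operatorname{gph}F$ and $g:Y\to\mathbb R_+$ be as in the context. (i) ${}^sr_g[F](\bar x,\bar y)\le\overline{|\nabla F|}{}^{\diamond}_g(\bar x,\bar y)$. (ii) If $X$ and $Y$ are complete and $\operatorname{gph}F$ is locally closed near $(\bar x,\bar y)$, then ${}^sr_g[F](\bar x,\bar y)=\overline{|\nabla F|}{}^{\diamond}_g(\bar x,\bar y)$.
   Context: $F:X\rightrightarrows Y$ is a set-valued mapping between metric spaces, $\operatorname{gph}F=\{(x,y): y\in F(x)\}$, $F^{-1}(y)=\{x: y\in F(x)\}$, $(\bar x,\bar y)\in\operatorname{gph}F$. A set $\Omega$ is locally closed near $\bar z\in\Omega$ iff $\Omega\cap U$ is closed for some closed neighbourhood $U$ of $\bar z$. Standing assumptions on $g:Y\to\mathbb R_+=[0,\infty)$: $g(\bar y)=0$; $g$ is continuous at $\bar y$ and locally Lipschitz continuous on $Y\setminus\{\bar y\}$; $g(y)>0$ for $y\ne\bar y$; $\liminf_{g(y)\downarrow0}g(y)/d(y,\bar y)>0$. The modulus of metric $g$-subregularity is $${}^sr_g[F](\bar x,\bar y)=\liminf_{x\to\bar x,\ x\notin F^{-1}(\bar y),\ y\in F(x)}\frac{g(y)}{d(x,F^{-1}(\bar y))}$$ (with $a/0=+\infty$ for $a>0$ and the infimum over the empty set equal to $+\infty$); it is the supremum of all $\tau>0$ such that, for some neighbourhood $U$ of $\bar x$, $\tau d(x,F^{-1}(\bar y))\le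 g(y)$ for all $x\in U$, $y\in F(x)$ (understood as $0$ if there is no such $\tau$). For $\rho>0$ and $(x,y)\in\operatorname{gph}F$, with $d_\rho((x,y),(u,v))=\max\{d(x,u),\rho\,d(y,v)\}$ and $\alpha_+=\max\{\alpha,0\}$, $$|\nabla F|^{\diamond}_{g,\rho}(x,y)=\sup_{(u,v)\ne(x,y),\,(u,v)\in\operatorname{gph}F}\frac{[g(y)-g(v)]_+}{d_\rho((u,v),(x,y))},$$ and $\overline{|\nabla F|}{}^{\diamond}_g(\bar x,\bar y)=\lim_{\rho\downarrow0}\inf\{|\nabla F|^{\diamond}_{g,\rho}(x,y): (x,y)\in\operatorname{gph}F,\ d(x,\bar x)<\rho,\ d(y,\bar y)<\rho,\ x\notin F^{-1}(\bar y)\}$. *)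

theory Defs
  imports "HOL-Analysis.Analysis"
begin

text \<open>A set-valued mapping from X to Y is a function \<open>F :: 'x \<Rightarrow> 'y set\<close>. Nonnegative extended
  reals are \<^typ>\<open>ennreal\<close>: there \<open>a / 0 = \<infinity>\<close> for \<open>a > 0\<close>, the infimum of the empty set is \<open>\<infinity>\<close>,
  and the supremum of the empty set is \<open>0\<close>.\<close>

definition gph :: "('x \<Rightarrow> 'y set) \<Rightarrow> ('x \<times> 'y) set" where
  "gph F = {(x, y). y \<in> F x}"

definition set_inverse :: "('x \<Rightarrow> 'y set) \<Rightarrow> 'y \<Rightarrow> 'x set" where
  "set_inverse F y = {x. y \<in> F x}"

definition locally_closed_near :: "'a::topological_space set \<Rightarrow> 'a \<Rightarrow> bool" where
  "locally_closed_near \<Omega> z \<longleftrightarrow> (\<exists>U. closed U \<and> z \<in> interior U \<and> closed (\<Omega> \<inter> U))"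

definition locally_lipschitz_on :: "'a::metric_space set \<Rightarrow> ('a \<Rightarrow> 'b::metric_space) \<Rightarrow> bool" where
  "locally_lipschitz_on S f \<longleftrightarrow> (\<forall>x\<in>S. \<exists>\<epsilon>>0. \<exists>L. L-lipschitz_on (ball x \<epsilon> \<inter> S) f)"

text \<open>The lower limit runs over pairs \<open>(x, y)\<close> of the graph with \<open>x\<close> outside the inverse image; only
  \<open>x\<close> is required to converge. If there are no such pairs with \<open>x\<close> near \<open>xbar\<close>, the filter is trivial
  and the value is \<open>\<infinity>\<close>.\<close>

definition subreg_modulus ::
  "('y \<Rightarrow> real) \<Rightarrow> ('x::metric_space \<Rightarrow> 'y set) \<Rightarrow> 'x \<Rightarrow> 'y \<Rightarrow> ennreal" where
  "subreg_modulus g F xbar ybar =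
     Liminf (inf (filtercomap fst (nhds xbar))
                 (principal {(x, y). x \<notin> set_inverse F ybar \<and> y \<in> F x}))
       (\<lambda>(x, y). ennreal (g y) / ennreal (infdist x (set_inverse F ybar)))"

definition dist_rho ::
  "real \<Rightarrow> 'x::metric_space \<times> 'y::metric_space \<Rightarrow> 'x \<times> 'y \<Rightarrow> real" where
  "dist_rho \<rho> p q = max (dist (fst p) (fst q)) (\<rho> * dist (snd p) (snd q))"

definition nonlocal_slope ::
  "('y \<Rightarrow> real) \<Rightarrow> real \<Rightarrow> ('x::metric_space \<Rightarrow> 'y::metric_space set) \<Rightarrow> 'x \<Rightarrow> 'y \<Rightarrow> ennreal" where
  "nonlocal_slope g \<rho> F x y =
     (SUP (u, v) \<in> gph F - {(x, y)}.
        ennreal (max (g y - g v) 0) / ennreal (dist_rho \<rho> (u, v) (x, y)))"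

definition strict_slope_inf ::
  "('y \<Rightarrow> real) \<Rightarrow> ('x::metric_space \<Rightarrow> 'y::metric_space set) \<Rightarrow> 'x \<Rightarrow> 'y \<Rightarrow> real \<Rightarrow> ennreal" where
  "strict_slope_inf g F xbar ybar \<rho> =
     (INF (x, y) \<in> {(x, y) \<in> gph F. dist x xbar < \<rho> \<and> dist y ybar < \<rho> \<and> x \<notin> set_inverse F ybar}.
        nonlocal_slope g \<rho> F x y)"

definition strict_slope ::
  "('y \<Rightarrow> real) \<Rightarrow> ('x::metric_space \<Rightarrow> 'y::metric_space set) \<Rightarrow> 'x \<Rightarrow> 'y \<Rightarrow> ennreal" where
  "strict_slope g F xbar ybar = Lim (at_right 0) (strict_slope_inf g F xbar ybar)"

text \<open>The limit in the definition of \<^const>\<open>strict_slope\<close> always exists, by monotonicity in \<open>\<rho>\<close>.\<close>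

lemma ennreal_inverse_antimono:
  fixes a b :: ennreal
  shows "a \<le> b \<Longrightarrow> inverse b \<le> inverse a"
  including ennreal.lifting by transfer (rule ereal_inverse_antimono)

lemma nonlocal_slope_antimono:
  fixes F :: "'x::metric_space \<Rightarrow> 'y::metric_space set"
  assumes "0 < \<rho>" "\<rho> \<le> \<rho>'"
  shows "nonlocal_slope g \<rho>' F x y \<le> nonlocal_slope g \<rho> F x y"
proof -
  have "dist_rho \<rho> p q \<le> dist_rho \<rho>' p q" for p q :: "'x \<times> 'y"
    using assms unfolding dist_rho_def by (intro max.mono mult_right_mono) auto
  then show ?thesis
    unfolding nonlocal_slope_def
    by (intro SUP_mono)
      (auto simp: divide_ennreal_def intro!: bexI mult_left_mono ennreal_inverse_antimono ennreal_leI)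
qed

lemma strict_slope_inf_antimono:
  assumes "0 < \<rho>" "\<rho> \<le> \<rho>'"
  shows "strict_slope_inf g F xbar ybar \<rho>' \<le> strict_slope_inf g F xbar ybar \<rho>"
  unfolding strict_slope_inf_def
  by (rule INF_mono) (use assms nonlocal_slope_antimono[OF assms] in \<open>force\<close>)

lemma strict_slope_inf_tendsto:
  "(strict_slope_inf g F xbar ybar \<longlongrightarrow> strict_slope g F xbar ybar) (at_right 0)"
proof -
  let ?f = "strict_slope_inf g F xbar ybar"
  have *: "(?f \<longlongrightarrow> (SUP \<rho>\<in>{0<..}. ?f \<rho>)) (at_right 0)"
  proof (rule order_tendstoI)
    fix a assume "a < (SUP \<rho>\<in>{0<..}. ?f \<rho>)"
    then obtain r where r: "0 < r" "a < ?f r" by (auto simp: less_SUP_iff)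
    show "\<forall>\<^sub>F \<rho> in at_right 0. a < ?f \<rho>"
      using r(1) by (intro eventually_at_rightI[of 0 r])
        (auto intro!: less_le_trans[OF r(2)] strict_slope_inf_antimono)
  next
    fix a assume "(SUP \<rho>\<in>{0<..}. ?f \<rho>) < a"
    then show "\<forall>\<^sub>F \<rho> in at_right 0. ?f \<rho> < a"
      using eventually_at_right_less[of "0::real"]
      by (auto elim!: eventually_mono intro: le_less_trans[OF SUP_upper])
  qed
  then show ?thesis
    unfolding strict_slope_def using tendsto_Lim[OF _ *] by simp
qed

end

theory Submission
  imports Defs
begin

text \<open>For (i), nearly nearest points of the inverse image of \<open>ybar\<close>, paired with \<open>ybar\<close>, serve as
  test points in the nonlocal slope; the growth condition on \<open>g\<close> makes the \<open>\<rho>\<close>-weighted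
  \<open>y\<close>-distance negligible. For (ii), if the subregularity modulus lies below \<open>\<gamma>\<close>, some \<open>(x, y)\<close>
  near the reference point has \<open>g y < \<gamma> d(x, F\<^sup>-\<^sup>1(ybar))\<close>. Ekeland's variational principle for
  \<open>(u, v) \<mapsto> g v\<close> on the closed part of the graph, with the metric \<open>d\<^sub>\<rho>\<close>, moves \<open>(x, y)\<close> by less than
  \<open>d(x, F\<^sup>-\<^sup>1(ybar))\<close> to a point where the nonlocal slope is at most \<open>\<gamma>\<close>.\<close>

section \<open>Ekeland's variational principle in a complete metric space\<close>

text \<open>An iteration from \<open>x0\<close> descends in Ekeland's order, each time realizing at
  least half of the possible decrease of \<open>f\<close>. Distances are controlled by decreases of
  \<open>f\<close>, so the sequence is Cauchy, and nothing lies strictly below its limit. Closed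
  sublevel sets express lower semicontinuity.\<close>

lemma (in Metric_space) ekeland_variational_principle:
  fixes f :: "'a \<Rightarrow> real"
  assumes complete: "mcomplete"
    and lsc: "\<And>a. closedin mtopology {x \<in> M. f x \<le> a}"
    and bdd: "\<And>x. x \<in> M \<Longrightarrow> b \<le> f x"
    and "x0 \<in> M" "0 < \<gamma>"
  obtains x where "x \<in> M" "f x + \<gamma> * d x x0 \<le> f x0"
    "\<And>u. u \<in> M \<Longrightarrow> u \<noteq> x \<Longrightarrow> f x < f u + \<gamma> * d u x"
proof -
  \<comment> \<open>\<open>S w\<close> is the set of points below \<open>w\<close> in Ekeland's
    order. The goal is a point \<open>x\<close> of \<open>S x0\<close> with
    \<open>S x = {x}\<close>.\<close>
  define S where "S w = {z \<in> M. f z + \<gamma> * d z w \<le> f w}" for w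
  have S_self: "w \<in> S w" if "w \<in> M" for w
    using that by (simp add: S_def)
  have S_trans: "z \<in> S w" if "z \<in> S v" "v \<in> S w" "w \<in> M" for z v w
  proof -
    have "\<gamma> * d z w \<le> \<gamma> * (d z v + d v w)"
      using that \<open>0 < \<gamma>\<close> by (intro mult_left_mono triangle) (auto simp: S_def)
    then show ?thesis
      using that by (auto simp: S_def distrib_left)
  qed
  have bdd_S: "bdd_below (f ` S w)" for w
    using bdd by (auto simp: S_def bdd_below_def)
  \<comment> \<open>The point \<open>v\<close> has a value at most halfway between
    \<open>f w\<close> and the infimum over \<open>S w\<close>. As \<open>S v\<close> is contained
    in \<open>S w\<close>, no further decrease below \<open>v\<close> can exceed the one just
    made.\<close>
  have step: "\<exists>v. v \<in> S w \<and> (\<forall>z\<in>S v. f v - f z \<le> f w - f v)" if "w \<in> M" for w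
  proof -
    let ?m = "INF z\<in>S w. f z"
    have m_le: "?m \<le> f z" if "z \<in> S w" for z
      using bdd_S that by (rule cINF_lower)
    have "\<exists>v\<in>S w. 2 * f v \<le> f w + ?m"
    proof (cases "?m < f w")
      case True
      then have "?m < (f w + ?m) / 2" by simp
      then obtain v where "v \<in> S w" "f v < (f w + ?m) / 2"
        using cINF_less_iff[OF _ bdd_S, of w] S_self[OF \<open>w \<in> M\<close>] by blast
      then show ?thesis by (auto intro!: bexI[of _ v])
    next
      case False
      then show ?thesis
        using S_self[OF that] by (auto intro!: bexI[of _ w])
    qed
    then obtain v where v: "v \<in> S w" "2 * f v \<le> f w + ?m" by blast
    have "f v - f z \<le> f w - f v" if "z \<in> S v" for z
      using m_le[OF S_trans[OF that v(1) \<open>w \<in> M\<close>]] v(2) by simp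
    with v(1) show ?thesis by blast
  qed
  obtain w where w0: "w 0 = x0" and w_M: "\<And>n. w n \<in> M"
    and w_S: "\<And>n. w (Suc n) \<in> S (w n)"
    and w_min: "\<And>n z. z \<in> S (w (Suc n)) \<Longrightarrow> f (w (Suc n)) - f z \<le> f (w n) - f (w (Suc n))"
  proof -
    \<comment> \<open>The clause for \<open>n = 0\<close> in the invariant pins the sequence to the
      start \<open>x0\<close>.\<close>
    have "\<exists>w. \<forall>n. (w n \<in> M \<and> (n = 0 \<longrightarrow> w n = x0)) \<and>
        (w (Suc n) \<in> S (w n) \<and>
          (\<forall>z\<in>S (w (Suc n)). f (w (Suc n)) - f z \<le> f (w n) - f (w (Suc n))))"
    proof (rule dependent_nat_choice)
      show "\<exists>x. x \<in> M \<and> (0 = (0::nat) \<longrightarrow> x = x0)"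
        using \<open>x0 \<in> M\<close> by blast
    next
      fix x and n :: nat
      assume "x \<in> M \<and> (n = 0 \<longrightarrow> x = x0)"
      then obtain v where "v \<in> S x" "\<forall>z\<in>S v. f v - f z \<le> f x - f v"
        using step by blast
      then show "\<exists>y. (y \<in> M \<and> (Suc n = 0 \<longrightarrow> y = x0)) \<and>
          (y \<in> S x \<and> (\<forall>z\<in>S y. f y - f z \<le> f x - f y))"
        by (auto simp: S_def)
    qed
    then show ?thesis using that by blast
  qed
  have w_S_le: "w n \<in> S (w m)" if "m \<le> n" for m n
    using that by (induction n rule: dec_induct) (auto intro: S_self S_trans w_M w_S)
  have dist_w: "\<gamma> * d (w n) (w m) \<le> f (w m) - f (w n)" if "m \<le> n" for m n
    using w_S_le[OF that] by (simp add: S_def)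
  have dist_w_nonneg: "0 \<le> \<gamma> * d y z" for y z
    using \<open>0 < \<gamma>\<close> by simp
  have "decseq (\<lambda>n. f (w n))"
    unfolding decseq_def by (smt (verit) dist_w dist_w_nonneg)
  moreover have "\<And>n. b \<le> f (w n)"
    using bdd w_M by blast
  ultimately obtain L where L: "(\<lambda>n. f (w n)) \<longlonglongrightarrow> L" "\<And>n. L \<le> f (w n)"
    using decseq_convergent[of "\<lambda>n. f (w n)" b] by blast
  \<comment> \<open>The values \<open>f (w n)\<close> converge, and by \<open>dist_w\<close> their
    differences dominate the distances.\<close>
  have "MCauchy w"
    unfolding MCauchy_def
  proof (intro conjI allI impI)
    show "range w \<subseteq> M" using w_M by blast
    fix \<epsilon> :: real assume "0 < \<epsilon>"
    then have "L < L + \<gamma> * \<epsilon>" using \<open>0 < \<gamma>\<close> by simp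
    then obtain N where N: "f (w n) < L + \<gamma> * \<epsilon>" if "N \<le> n" for n
      using order_tendstoD(2)[OF L(1)] unfolding eventually_sequentially by blast
    have *: "d (w n') (w n) < \<epsilon>" if "N \<le> n" "n \<le> n'" for n n'
    proof -
      have "\<gamma> * d (w n') (w n) < \<gamma> * \<epsilon>"
        using dist_w[OF that(2)] N[OF that(1)] L(2)[of n'] by linarith
      then show ?thesis using \<open>0 < \<gamma>\<close> by simp
    qed
    show "\<exists>N. \<forall>n n'. N \<le> n \<longrightarrow> N \<le> n' \<longrightarrow> d (w n) (w n') < \<epsilon>"
      using * commute by (metis nle_le)
  qed
  then obtain x where lim: "limitin mtopology w x sequentially"
    using complete by (auto simp: mcomplete_def)
  then have x: "x \<in> M" and dist_lim: "(\<lambda>n. d (w n) x) \<longlonglongrightarrow> 0"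
    by (auto simp: limitin_metric_dist_null)
  \<comment> \<open>From index \<open>n\<close> on, the sequence stays in a closed sublevel set,
    which therefore contains the limit.\<close>
  have "f x \<le> f (w n)" for n
  proof -
    have "\<forall>\<^sub>F m in sequentially. w m \<in> {z \<in> M. f z \<le> f (w n)}"
      using eventually_ge_at_top[of n]
      by eventually_elim (use w_M \<open>decseq (\<lambda>n. f (w n))\<close> in \<open>auto simp: decseq_def\<close>)
    then show ?thesis
      using limitin_closedin[OF lim lsc] by auto
  qed
  then have "f x \<le> L"
    using L(1) by (auto intro: LIMSEQ_le_const)
  \<comment> \<open>Let \<open>m\<close> tend to infinity in the triangle inequality through
    \<open>w m\<close>.\<close>
  have x_S: "x \<in> S (w n)" for n
  proof -
    have "\<gamma> * d (w n) x \<le> \<gamma> * d (w m) x + (f (w n) - f (w m))" if "n \<le> m" for m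
      using mult_left_mono[OF triangle[OF w_M w_M x, of n m], of \<gamma>] dist_w[OF that] \<open>0 < \<gamma>\<close>
      by (simp add: distrib_left commute)
    moreover have "(\<lambda>m. \<gamma> * d (w m) x + (f (w n) - f (w m))) \<longlonglongrightarrow> \<gamma> * 0 + (f (w n) - L)"
      by (intro tendsto_intros dist_lim L(1))
    ultimately have "\<gamma> * d (w n) x \<le> \<gamma> * 0 + (f (w n) - L)"
      by (intro LIMSEQ_le_const) auto
    then show ?thesis
      using \<open>f x \<le> L\<close> x by (simp add: S_def commute)
  qed
  \<comment> \<open>A point \<open>u\<close> violating this would lie in every
    \<open>S (w (Suc n))\<close>, so \<open>w_min\<close> bounds its distance to the sequence by
    decreases of \<open>f\<close> that tend to 0; hence \<open>u\<close> would equal the limit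
    \<open>x\<close>.\<close>
  have "f x < f u + \<gamma> * d u x" if "u \<in> M" "u \<noteq> x" for u
  proof (rule ccontr)
    assume "\<not> ?thesis"
    then have "u \<in> S x" using that by (simp add: S_def)
    have u_w: "\<gamma> * d u (w (Suc n)) \<le> f (w n) - f (w (Suc n))" for n
    proof -
      have "u \<in> S (w (Suc n))"
        using S_trans[OF \<open>u \<in> S x\<close> x_S w_M] .
      then show ?thesis
        using w_min[of u n] by (auto simp: S_def)
    qed
    have "\<gamma> * d u x \<le> (f (w n) - f (w (Suc n))) + \<gamma> * d (w (Suc n)) x" for n
      using mult_left_mono[OF triangle[OF \<open>u \<in> M\<close> w_M x, of "Suc n"], of \<gamma>] u_w[of n] \<open>0 < \<gamma>\<close>
      by (simp add: distrib_left)
    moreover have "(\<lambda>n. (f (w n) - f (w (Suc n))) + \<gamma> * d (w (Suc n)) x) \<longlonglongrightarrow> (L - L) + \<gamma> * 0"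
      by (intro tendsto_intros LIMSEQ_Suc[OF L(1)] LIMSEQ_Suc[OF dist_lim] L(1))
    ultimately have "\<gamma> * d u x \<le> (L - L) + \<gamma> * 0"
      by (intro LIMSEQ_le_const) auto
    then have "d u x = 0"
      using \<open>0 < \<gamma>\<close> nonneg[of u x] by (simp add: mult_le_0_iff)
    then show False using that x by simp
  qed
  with x x_S[of 0] that show ?thesis
    by (auto simp: w0 S_def)
qed

section \<open>The weighted product metric on a set of pairs\<close>

text \<open>Lets Ekeland's principle run with the metric of the slope on a part of the graph.
  Positivity of \<open>\<rho>\<close> is what separates points with equal first components.\<close>

lemma Metric_space_dist_rho:
  fixes A :: "('x::metric_space \<times> 'y::metric_space) set"
  assumes "0 < \<rho>"
  shows "Metric_space A (dist_rho \<rho>)"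
proof
  fix p q r :: "'x \<times> 'y"
  show "0 \<le> dist_rho \<rho> p q"
    by (simp add: dist_rho_def le_max_iff_disj)
  show "dist_rho \<rho> p q = dist_rho \<rho> q p"
    by (simp add: dist_rho_def dist_commute)
  show "dist_rho \<rho> p q = 0 \<longleftrightarrow> p = q"
  proof
    assume "dist_rho \<rho> p q = 0"
    then have "dist (fst p) (fst q) \<le> 0" "\<rho> * dist (snd p) (snd q) \<le> 0"
      by (auto simp: dist_rho_def max_def split: if_splits)
    then show "p = q"
      using assms by (auto simp: mult_le_0_iff prod_eq_iff)
  qed (simp add: dist_rho_def)
  show "dist_rho \<rho> p r \<le> dist_rho \<rho> p q + dist_rho \<rho> q r"
  proof -
    have "\<rho> * dist (snd p) (snd r) \<le> \<rho> * dist (snd p) (snd q) + \<rho> * dist (snd q) (snd r)"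
      using mult_left_mono[OF dist_triangle, of \<rho> "snd p" "snd r" "snd q"] assms
      by (simp add: distrib_left)
    then show ?thesis
      using dist_triangle[of "fst p" "fst r" "fst q"] by (auto simp: dist_rho_def)
  qed
qed

text \<open>The component distances are at most \<open>dist_rho\<close> and \<open>dist_rho\<close>
  divided by \<open>\<rho>\<close>; conversely \<open>dist_rho\<close> is continuous. This carries
  closedness and continuity from the product topology over to the weighted metric.\<close>

lemma tendsto_dist_rho_iff:
  assumes "0 < \<rho>"
  shows "((\<lambda>n. dist_rho \<rho> (\<sigma> n) l) \<longlongrightarrow> 0) G \<longleftrightarrow> (\<sigma> \<longlongrightarrow> l) G"
proof
  assume *: "((\<lambda>n. dist_rho \<rho> (\<sigma> n) l) \<longlongrightarrow> 0) G"
  have "((\<lambda>n. fst (\<sigma> n)) \<longlongrightarrow> fst l) G"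
    by (rule metric_tendsto_imp_tendsto[OF *]) (auto simp: dist_rho_def intro!: always_eventually)
  moreover have "((\<lambda>n. snd (\<sigma> n)) \<longlongrightarrow> snd l) G"
  proof (rule metric_tendsto_imp_tendsto)
    show "((\<lambda>n. dist_rho \<rho> (\<sigma> n) l / \<rho>) \<longlongrightarrow> 0) G"
      using tendsto_divide[OF * tendsto_const, of \<rho>] assms by simp
    show "\<forall>\<^sub>F n in G. dist (snd (\<sigma> n)) (snd l) \<le> dist (dist_rho \<rho> (\<sigma> n) l / \<rho>) 0"
      using assms by (auto simp: dist_rho_def field_simps intro!: always_eventually)
  qed
  ultimately show "(\<sigma> \<longlongrightarrow> l) G"
    using tendsto_Pair by fastforce
next
  assume *: "(\<sigma> \<longlongrightarrow> l) G"
  have "((\<lambda>n. dist_rho \<rho> (\<sigma> n) l) \<longlongrightarrow> max (dist (fst l) (fst l)) (\<rho> * dist (snd l) (snd l))) G"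
    unfolding dist_rho_def by (intro tendsto_intros *)
  then show "((\<lambda>n. dist_rho \<rho> (\<sigma> n) l) \<longlongrightarrow> 0) G" by simp
qed

text \<open>Both components of a Cauchy sequence are Cauchy, so they converge in the complete
  factors, and closedness keeps the limit in \<open>A\<close>.\<close>

lemma mcomplete_dist_rho:
  fixes A :: "('x::metric_space \<times> 'y::metric_space) set"
  assumes "0 < \<rho>" "closed A" "complete (UNIV :: 'x set)" "complete (UNIV :: 'y set)"
  shows "Metric_space.mcomplete A (dist_rho \<rho>)"
proof -
  interpret Metric_space A "dist_rho \<rho>"
    by (rule Metric_space_dist_rho) fact
  show ?thesis
    unfolding mcomplete_def
  proof (intro allI impI)
    fix \<sigma> assume "MCauchy \<sigma>"
    then have \<sigma>: "\<And>n. \<sigma> n \<in> A"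
      and Cauchy: "\<And>\<epsilon>. 0 < \<epsilon> \<Longrightarrow> \<exists>N. \<forall>n n'. N \<le> n \<longrightarrow> N \<le> n' \<longrightarrow> dist_rho \<rho> (\<sigma> n) (\<sigma> n') < \<epsilon>"
      by (auto simp: MCauchy_def)
    have "Cauchy (\<lambda>n. fst (\<sigma> n))"
      unfolding Cauchy_def
    proof (intro allI impI)
      fix e :: real assume "0 < e"
      from Cauchy[OF this] show "\<exists>N. \<forall>m\<ge>N. \<forall>n\<ge>N. dist (fst (\<sigma> m)) (fst (\<sigma> n)) < e"
        by (auto simp: dist_rho_def)
    qed
    moreover have "Cauchy (\<lambda>n. snd (\<sigma> n))"
      unfolding Cauchy_def
    proof (intro allI impI)
      fix e :: real assume "0 < e"
      \<comment> \<open>The tolerance \<open>\<rho> * e\<close> compensates for the weight on the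
        second component.\<close>
      with \<open>0 < \<rho>\<close> have "0 < \<rho> * e" by simp
      from Cauchy[OF this] show "\<exists>N. \<forall>m\<ge>N. \<forall>n\<ge>N. dist (snd (\<sigma> m)) (snd (\<sigma> n)) < e"
        using \<open>0 < \<rho>\<close> by (auto simp: dist_rho_def)
    qed
    ultimately obtain a b where "(\<lambda>n. fst (\<sigma> n)) \<longlonglongrightarrow> a" "(\<lambda>n. snd (\<sigma> n)) \<longlonglongrightarrow> b"
      using assms(3,4) unfolding complete_def by blast
    then have lim: "\<sigma> \<longlonglongrightarrow> (a, b)"
      using tendsto_Pair by fastforce
    moreover have "(a, b) \<in> A"
      using closed_sequentially[OF \<open>closed A\<close> \<sigma> lim] .
    ultimately show "\<exists>x. limitin mtopology \<sigma> x sequentially"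
      using \<sigma> lim by (auto simp: limitin_metric_dist_null tendsto_dist_rho_iff[OF \<open>0 < \<rho>\<close>])
  qed
qed

text \<open>Supplies the lower semicontinuity hypothesis of Ekeland's principle.\<close>

lemma closedin_sublevel_dist_rho:
  assumes "0 < \<rho>" "continuous_on UNIV (f :: 'x::metric_space \<times> 'y::metric_space \<Rightarrow> real)"
  shows "closedin (Metric_space.mtopology A (dist_rho \<rho>)) {p \<in> A. f p \<le> a}"
proof -
  interpret Metric_space A "dist_rho \<rho>"
    by (rule Metric_space_dist_rho) fact
  show ?thesis
    unfolding metric_closedin_iff_sequentially_closed
  proof (intro conjI allI impI)
    fix \<sigma> l
    assume *: "range \<sigma> \<subseteq> {p \<in> A. f p \<le> a} \<and> limitin mtopology \<sigma> l sequentially"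
    then have "l \<in> A" "\<sigma> \<longlonglongrightarrow> l"
      by (auto simp: limitin_metric_dist_null tendsto_dist_rho_iff[OF \<open>0 < \<rho>\<close>])
    then have "(\<lambda>n. f (\<sigma> n)) \<longlonglongrightarrow> f l"
      using assms(2) by (auto intro: continuous_on_tendsto_compose)
    then have "f l \<le> a"
      by (rule LIMSEQ_le_const2) (use * in auto)
    with \<open>l \<in> A\<close> show "l \<in> {p \<in> A. f p \<le> a}" by simp
  qed auto
qed

section \<open>Continuity and linear growth of \<open>g\<close>\<close>

lemma locally_lipschitz_on_imp_continuous_on:
  assumes "locally_lipschitz_on S f"
  shows "continuous_on S f"
  unfolding continuous_on_eq_continuous_within
proof
  fix x assume "x \<in> S"
  then obtain \<epsilon> L where "0 < \<epsilon>" "L-lipschitz_on (ball x \<epsilon> \<inter> S) f"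
    using assms unfolding locally_lipschitz_on_def by blast
  then have "continuous (at x within S \<inter> ball x \<epsilon>) f"
    using \<open>x \<in> S\<close> \<open>0 < \<epsilon>\<close> lipschitz_on_continuous_within[of L "ball x \<epsilon> \<inter> S" f x]
    by (simp add: Int_commute)
  then show "continuous (at x within S) f"
    using \<open>0 < \<epsilon>\<close> at_within_nhd[of x "ball x \<epsilon>" S "S \<inter> ball x \<epsilon>"]
    by (auto simp: continuous_within)
qed

text \<open>Any number strictly between 0 and the lower limit is a growth constant. The filter
  restricts the values of \<open>g\<close>, not the position of \<open>y\<close>, so the bound holds
  wherever \<open>g\<close> is small; there, small values of \<open>g\<close> force \<open>y\<close>
  to be near \<open>ybar\<close>.\<close>

lemma linear_growth_of_Liminf:
  fixes g :: "'y::metric_space \<Rightarrow> real"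
  assumes "\<And>y. y \<noteq> ybar \<Longrightarrow> g y > 0" "g ybar = 0"
    and "Liminf (filtercomap g (at_right 0)) (\<lambda>y. ennreal (g y) / ennreal (dist y ybar)) > 0"
  obtains c \<delta> where "0 < c" "0 < \<delta>" "\<And>y. g y < \<delta> \<Longrightarrow> c * dist y ybar \<le> g y"
proof -
  obtain c' where "0 < c'"
    and c': "c' < Liminf (filtercomap g (at_right 0)) (\<lambda>y. ennreal (g y) / ennreal (dist y ybar))"
    using dense[OF assms(3)] by blast
  then obtain c where c: "c' = ennreal c" "0 < c"
    by (cases c' rule: ennreal_cases) (auto simp: top_unique less_top[symmetric])
  obtain P where P: "eventually P (at_right 0)"
    "\<And>y. P (g y) \<Longrightarrow> c' < ennreal (g y) / ennreal (dist y ybar)"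
    using less_LiminfD[OF c'] by (auto simp: eventually_filtercomap)
  then obtain \<delta> where \<delta>: "0 < \<delta>" "\<And>t. 0 < t \<Longrightarrow> t < \<delta> \<Longrightarrow> P t"
    by (auto simp: eventually_at_right_field)
  have "c * dist y ybar \<le> g y" if "g y < \<delta>" for y
  proof (cases "y = ybar")
    case False
    then have "0 < g y" using assms(1) by simp
    then have "ennreal c < ennreal (g y / dist y ybar)"
      using P(2)[OF \<delta>(2)[OF _ that]] False by (simp add: c(1) divide_ennreal)
    then show ?thesis
      using False \<open>0 < c\<close> by (simp add: ennreal_less_iff field_simps)
  qed (use assms in simp)
  with \<open>0 < c\<close> \<delta>(1) that show ?thesis by blast
qed

section \<open>Real inequalities behind the subregularity modulus and the slopes\<close>

lemma eventually_graph_filter_iff: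
  "eventually P (inf (filtercomap fst (nhds xbar)) (principal {(x, y). x \<notin> S \<and> y \<in> F x})) \<longleftrightarrow>
    (\<exists>r>0. \<forall>x y. dist (x::'x::metric_space) xbar < r \<longrightarrow> x \<notin> S \<longrightarrow> y \<in> F x \<longrightarrow> P (x, y))"
  (is "?L \<longleftrightarrow> ?R")
proof
  assume ?L
  then show ?R
    by (fastforce simp: eventually_inf_principal eventually_filtercomap eventually_nhds_metric)
next
  assume ?R
  then obtain r where "0 < r" "\<forall>x y. dist x xbar < r \<longrightarrow> x \<notin> S \<longrightarrow> y \<in> F x \<longrightarrow> P (x, y)"
    by blast
  then show ?L
    unfolding eventually_inf_principal eventually_filtercomap eventually_nhds_metric
    by (intro exI[of _ "\<lambda>x. dist x xbar < r"]) auto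
qed

text \<open>Since \<open>x\<close> lies outside the inverse image, \<open>y\<close> differs from
  \<open>ybar\<close> and \<open>g y > 0\<close>. This settles the case of distance 0, where the
  quotient is infinite; otherwise the quotient is real and can be cleared.\<close>

lemma subreg_modulus_greaterD:
  assumes "\<And>y. y \<noteq> ybar \<Longrightarrow> g y > 0" "0 < \<gamma>" "ennreal \<gamma> < subreg_modulus g F xbar ybar"
  obtains r where "0 < r"
    "\<And>x y. dist x xbar < r \<Longrightarrow> x \<notin> set_inverse F ybar \<Longrightarrow> y \<in> F x \<Longrightarrow>
      \<gamma> * infdist x (set_inverse F ybar) < g y"
proof -
  obtain r where "0 < r" and r: "\<And>x y. dist x xbar < r \<Longrightarrow> x \<notin> set_inverse F ybar \<Longrightarrow> y \<in> F x \<Longrightarrow>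
      ennreal \<gamma> < ennreal (g y) / ennreal (infdist x (set_inverse F ybar))"
    using less_LiminfD[OF assms(3)[unfolded subreg_modulus_def]]
    by (auto simp: eventually_graph_filter_iff)
  have "\<gamma> * infdist x (set_inverse F ybar) < g y"
    if "dist x xbar < r" "x \<notin> set_inverse F ybar" "y \<in> F x" for x y
  proof -
    have "0 < g y" using that assms(1)[of y] by (auto simp: set_inverse_def)
    show ?thesis
    proof (cases "infdist x (set_inverse F ybar) = 0")
      case False
      then have pos: "0 < infdist x (set_inverse F ybar)"
        using infdist_nonneg[of x "set_inverse F ybar"] by linarith
      then have "ennreal \<gamma> < ennreal (g y / infdist x (set_inverse F ybar))"
        using r[OF that] \<open>0 < g y\<close> by (simp add: divide_ennreal)
      then show ?thesis
        using pos \<open>0 < \<gamma>\<close> by (simp add: ennreal_less_iff field_simps)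
    qed (use \<open>0 < g y\<close> in simp)
  qed
  with \<open>0 < r\<close> that show ?thesis by blast
qed

text \<open>If no such pair existed in the ball, \<open>\<gamma>\<close> would bound the quotients
  there from below, hence also the lower limit.\<close>

lemma subreg_modulus_lessD:
  assumes "\<And>y. y \<noteq> ybar \<Longrightarrow> g y > 0" "subreg_modulus g F xbar ybar < ennreal \<gamma>" "0 < r"
  obtains x y where "dist x xbar < r" "x \<notin> set_inverse F ybar" "y \<in> F x"
    "g y < \<gamma> * infdist x (set_inverse F ybar)"
proof -
  have "\<not> (\<forall>x y. dist x xbar < r \<longrightarrow> x \<notin> set_inverse F ybar \<longrightarrow> y \<in> F x \<longrightarrow>
      ennreal \<gamma> \<le> ennreal (g y) / ennreal (infdist x (set_inverse F ybar)))"
  proof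
    assume *: "\<forall>x y. dist x xbar < r \<longrightarrow> x \<notin> set_inverse F ybar \<longrightarrow> y \<in> F x \<longrightarrow>
      ennreal \<gamma> \<le> ennreal (g y) / ennreal (infdist x (set_inverse F ybar))"
    have "ennreal \<gamma> \<le> subreg_modulus g F xbar ybar"
      unfolding subreg_modulus_def
      by (rule Liminf_bounded) (use * \<open>0 < r\<close> in \<open>auto simp: eventually_graph_filter_iff\<close>)
    with assms(2) show False by simp
  qed
  then obtain x y where xy: "dist x xbar < r" "x \<notin> set_inverse F ybar" "y \<in> F x"
    and lt: "ennreal (g y) / ennreal (infdist x (set_inverse F ybar)) < ennreal \<gamma>"
    by (auto simp: not_le)
  have "0 < g y" using xy assms(1)[of y] by (auto simp: set_inverse_def)
  \<comment> \<open>At distance 0 the quotient would be infinite, because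
    \<open>g y > 0\<close>.\<close>
  have "infdist x (set_inverse F ybar) \<noteq> 0"
    using lt \<open>0 < g y\<close> by (auto simp: ennreal_divide_zero)
  then have pos: "0 < infdist x (set_inverse F ybar)"
    using infdist_nonneg[of x "set_inverse F ybar"] by linarith
  then have "ennreal (g y / infdist x (set_inverse F ybar)) < ennreal \<gamma>"
    using lt \<open>0 < g y\<close> by (simp add: divide_ennreal)
  then have "g y < \<gamma> * infdist x (set_inverse F ybar)"
    using pos \<open>0 < g y\<close> by (simp add: ennreal_less_iff field_simps)
  with xy that show ?thesis by blast
qed

lemma strict_slope_inf_le_strict_slope:
  assumes "0 < \<rho>"
  shows "strict_slope_inf g F xbar ybar \<rho> \<le> strict_slope g F xbar ybar"
proof (rule tendsto_lowerbound[OF strict_slope_inf_tendsto])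
  show "\<forall>\<^sub>F \<rho>' in at_right 0. strict_slope_inf g F xbar ybar \<rho> \<le> strict_slope_inf g F xbar ybar \<rho>'"
    using assms by (intro eventually_at_rightI[of 0 \<rho>]) (auto intro: strict_slope_inf_antimono)
qed simp

text \<open>One test point bounds the supremum from below. Different first components make the
  denominator positive and keep the test point apart from \<open>(x, y)\<close>.\<close>

lemma nonlocal_slope_geI:
  assumes "(u, v) \<in> gph F" "0 < dist u x" "0 < \<gamma>" "\<gamma> * dist_rho \<rho> (u, v) (x, y) \<le> g y - g v"
  shows "ennreal \<gamma> \<le> nonlocal_slope g \<rho> F x y"
proof -
  let ?d = "dist_rho \<rho> (u, v) (x, y)"
  have pos: "0 < ?d"
    using assms(2) by (simp add: dist_rho_def less_max_iff_disj)
  have "0 < \<gamma> * ?d" using pos \<open>0 < \<gamma>\<close> by simp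
  then have "\<gamma> \<le> max (g y - g v) 0 / ?d"
    using assms(4) pos by (simp add: field_simps)
  then have "ennreal \<gamma> \<le> ennreal (max (g y - g v) 0) / ennreal ?d"
    using pos by (simp add: divide_ennreal ennreal_leI)
  also have "\<dots> \<le> nonlocal_slope g \<rho> F x y"
    unfolding nonlocal_slope_def
    by (rule SUP_upper2[of "(u, v)"]) (use assms(1,2) in auto)
  finally show ?thesis .
qed

lemma nonlocal_slope_leI:
  fixes F :: "'x::metric_space \<Rightarrow> 'y::metric_space set"
  assumes "0 < \<rho>" "0 < \<gamma>"
    and "\<And>u v. (u, v) \<in> gph F \<Longrightarrow> (u, v) \<noteq> (x, y) \<Longrightarrow> g y - g v \<le> \<gamma> * dist_rho \<rho> (u, v) (x, y)"
  shows "nonlocal_slope g \<rho> F x y \<le> ennreal \<gamma>"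
  unfolding nonlocal_slope_def
proof (rule SUP_least)
  fix p assume "p \<in> gph F - {(x, y)}"
  then obtain u v where p: "p = (u, v)" and uv: "(u, v) \<in> gph F" "(u, v) \<noteq> (x, y)"
    by (cases p) auto
  interpret Metric_space UNIV "dist_rho \<rho> :: 'x \<times> 'y \<Rightarrow> 'x \<times> 'y \<Rightarrow> real"
    by (rule Metric_space_dist_rho) fact
  have pos: "0 < dist_rho \<rho> (u, v) (x, y)"
    using uv(2) by (simp add: less_le)
  \<comment> \<open>Taking the positive part is harmless because the right-hand side is
    positive.\<close>
  have "max (g y - g v) 0 \<le> \<gamma> * dist_rho \<rho> (u, v) (x, y)"
    using assms(3)[OF uv] pos \<open>0 < \<gamma>\<close> by simp
  then show "(case p of (u, v) \<Rightarrow>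
      ennreal (max (g y - g v) 0) / ennreal (dist_rho \<rho> (u, v) (x, y))) \<le> ennreal \<gamma>"
    using pos \<open>0 < \<gamma>\<close> by (simp add: p divide_ennreal ennreal_leI pos_divide_le_eq)
qed

section \<open>The modulus is at most the strict slope\<close>

lemma subreg_modulus_le_strict_slope:
  fixes F :: "'x::metric_space \<Rightarrow> 'y::metric_space set"
  assumes gph: "(xbar, ybar) \<in> gph F" and "g ybar = 0" and cont: "isCont g ybar"
    and pos: "\<And>y. y \<noteq> ybar \<Longrightarrow> g y > 0"
    and lim: "Liminf (filtercomap g (at_right 0)) (\<lambda>y. ennreal (g y) / ennreal (dist y ybar)) > 0"
  shows "subreg_modulus g F xbar ybar \<le> strict_slope g F xbar ybar"
proof (rule dense_le)
  \<comment> \<open>It suffices to treat numbers strictly below the modulus; these are finite, hence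
    images of reals.\<close>
  fix \<gamma>' assume less: "\<gamma>' < subreg_modulus g F xbar ybar"
  then obtain \<gamma> where \<gamma>': "\<gamma>' = ennreal \<gamma>"
    using less_top_ennreal order.strict_trans2[OF less top_greatest] by blast
  with less have "ennreal \<gamma> < subreg_modulus g F xbar ybar" by simp
  have "ennreal \<gamma> \<le> strict_slope g F xbar ybar" if "0 < \<gamma>"
  proof -
    obtain r where "0 < r" and r: "\<And>x y. dist x xbar < r \<Longrightarrow> x \<notin> set_inverse F ybar \<Longrightarrow>
        y \<in> F x \<Longrightarrow> \<gamma> * infdist x (set_inverse F ybar) < g y"
      using subreg_modulus_greaterD[OF pos \<open>0 < \<gamma>\<close> \<open>ennreal \<gamma> < subreg_modulus g F xbar ybar\<close>]
      by blast
    obtain c \<delta> where "0 < c" "0 < \<delta>" and c: "\<And>y. g y < \<delta> \<Longrightarrow> c * dist y ybar \<le> g y"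
      using linear_growth_of_Liminf[OF pos \<open>g ybar = 0\<close> lim] by blast
    obtain s where "0 < s" and s: "\<And>y. dist y ybar < s \<Longrightarrow> g y < \<delta>"
      using order_tendstoD(2)[OF cont[unfolded isCont_def], of \<delta>] \<open>g ybar = 0\<close> \<open>0 < \<delta>\<close>
      unfolding eventually_at by (metis UNIV_I)
    \<comment> \<open>The bound \<open>r\<close> gives the subregularity estimate at
      \<open>x\<close>, \<open>s\<close> puts \<open>y\<close> into the region of linear growth, and
      \<open>c / \<gamma>\<close> makes the weighted distance from \<open>y\<close> to
      \<open>ybar\<close>, times \<open>\<gamma>\<close>, at most \<open>g y\<close>.\<close>
    define \<rho> where "\<rho> = min r (min s (c / \<gamma>))"
    have "0 < \<rho>" "\<rho> \<le> r" "\<rho> \<le> s" "\<rho> \<le> c / \<gamma>"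
      using \<open>0 < r\<close> \<open>0 < s\<close> \<open>0 < c\<close> \<open>0 < \<gamma>\<close> by (simp_all add: \<rho>_def)
    then have "\<gamma> * \<rho> \<le> c"
      using \<open>0 < \<gamma>\<close> by (simp add: field_simps)
    have slope: "ennreal \<gamma> \<le> nonlocal_slope g \<rho> F x y"
      if "y \<in> F x" "dist x xbar < \<rho>" "dist y ybar < \<rho>" "x \<notin> set_inverse F ybar" for x y
    proof -
      have "\<gamma> * infdist x (set_inverse F ybar) < g y"
        using r that \<open>\<rho> \<le> r\<close> by simp
      \<comment> \<open>Nonemptiness is needed to read \<open>infdist\<close> as an infimum; for the
        empty set it is 0 by convention.\<close>
      moreover have ne: "set_inverse F ybar \<noteq> {}"
        using gph by (auto simp: set_inverse_def gph_def)
      ultimately have "(INF u\<in>set_inverse F ybar. dist x u) < g y / \<gamma>"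
        using \<open>0 < \<gamma>\<close> by (simp add: infdist_notempty field_simps)
      then obtain u where u: "u \<in> set_inverse F ybar" "dist x u < g y / \<gamma>"
        using cINF_less_iff[OF ne, of "dist x"] by (auto simp: bdd_below_def intro: zero_le_dist)
      have "\<gamma> * \<rho> * dist ybar y \<le> c * dist ybar y"
        using \<open>\<gamma> * \<rho> \<le> c\<close> by (intro mult_right_mono) auto
      also have "\<dots> \<le> g y"
        using c[OF s] that \<open>\<rho> \<le> s\<close> by (simp add: dist_commute)
      finally have "\<gamma> * (\<rho> * dist ybar y) \<le> g y"
        by (simp add: mult.assoc)
      moreover have "\<gamma> * dist u x \<le> g y"
        using u(2) \<open>0 < \<gamma>\<close> by (simp add: dist_commute field_simps)
      ultimately have "\<gamma> * dist_rho \<rho> (u, ybar) (x, y) \<le> g y - g ybar"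
        by (simp add: dist_rho_def max_def \<open>g ybar = 0\<close>)
      then show ?thesis
        using u(1) that(4) \<open>0 < \<gamma>\<close>
        by (intro nonlocal_slope_geI[of u ybar]) (auto simp: set_inverse_def gph_def)
    qed
    have "ennreal \<gamma> \<le> strict_slope_inf g F xbar ybar \<rho>"
      unfolding strict_slope_inf_def
      by (rule INF_greatest) (auto simp: gph_def intro: slope)
    also have "\<dots> \<le> strict_slope g F xbar ybar"
      using \<open>0 < \<rho>\<close> by (rule strict_slope_inf_le_strict_slope)
    finally show ?thesis .
  qed
  \<comment> \<open>For nonpositive \<open>\<gamma>\<close> the embedding \<open>ennreal\<close>
    gives 0 and the bound is trivial.\<close>
  then show "\<gamma>' \<le> strict_slope g F xbar ybar"
    unfolding \<gamma>' by (cases "0 < \<gamma>") (auto simp: ennreal_neg)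
qed

section \<open>The strict slope is at most the modulus for complete spaces and a locally closed
  graph\<close>

lemma strict_slope_le_subreg_modulus:
  fixes F :: "'x::metric_space \<Rightarrow> 'y::metric_space set"
  assumes gph: "(xbar, ybar) \<in> gph F" and g_nonneg: "\<And>y. g y \<ge> 0" and "g ybar = 0"
    and cont: "continuous_on UNIV g"
    and pos: "\<And>y. y \<noteq> ybar \<Longrightarrow> g y > 0"
    and lim: "Liminf (filtercomap g (at_right 0)) (\<lambda>y. ennreal (g y) / ennreal (dist y ybar)) > 0"
    and complete: "complete (UNIV :: 'x set)" "complete (UNIV :: 'y set)"
    and closed: "locally_closed_near (gph F) (xbar, ybar)"
  shows "strict_slope g F xbar ybar \<le> subreg_modulus g F xbar ybar"
proof (rule ccontr)
  assume "\<not> ?thesis"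
  then obtain \<gamma>' where \<gamma>': "subreg_modulus g F xbar ybar < \<gamma>'" "\<gamma>' < strict_slope g F xbar ybar"
    using dense by (metis not_le)
  then obtain \<gamma> where "\<gamma>' = ennreal \<gamma>"
    using less_top_ennreal order.strict_trans2[OF \<gamma>'(2) top_greatest] by blast
  with \<gamma>' have sub: "subreg_modulus g F xbar ybar < ennreal \<gamma>"
    and slope: "ennreal \<gamma> < strict_slope g F xbar ybar"
    by simp_all
  have "0 < \<gamma>"
    using sub by (cases "0 < \<gamma>") (auto simp: ennreal_neg)
  obtain c \<delta> where "0 < c" "0 < \<delta>" and c: "\<And>y. g y < \<delta> \<Longrightarrow> c * dist y ybar \<le> g y"
    using linear_growth_of_Liminf[OF pos \<open>g ybar = 0\<close> lim] by blast
  obtain U where U: "(xbar, ybar) \<in> interior U" "closed (gph F \<inter> U)"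
    using closed unfolding locally_closed_near_def by blast
  obtain r where "0 < r" and r: "\<And>u v. dist u xbar < r \<Longrightarrow> dist v ybar < r \<Longrightarrow> (u, v) \<in> U"
  proof -
    obtain A B where AB: "open A" "open B" "xbar \<in> A" "ybar \<in> B" "A \<times> B \<subseteq> interior U"
      using open_prod_elim[OF open_interior U(1)] by (metis mem_Times_iff fst_conv snd_conv)
    obtain a where "0 < a" "\<And>u. dist u xbar < a \<Longrightarrow> u \<in> A"
      using AB unfolding open_dist by blast
    moreover obtain b where "0 < b" "\<And>v. dist v ybar < b \<Longrightarrow> v \<in> B"
      using AB unfolding open_dist by blast
    ultimately show ?thesis
      using that[of "min a b"] AB(5) interior_subset[of U] by auto
  qed
  obtain \<rho> where "0 < \<rho>" and \<rho>: "ennreal \<gamma> < strict_slope_inf g F xbar ybar \<rho>"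
  proof -
    have "\<forall>\<^sub>F \<rho> in at_right 0. 0 < \<rho> \<and> ennreal \<gamma> < strict_slope_inf g F xbar ybar \<rho>"
      using order_tendstoD(1)[OF strict_slope_inf_tendsto slope] eventually_at_right_less
      by (rule eventually_conj[rotated])
    then show ?thesis
      using that eventually_happens'[OF trivial_limit_at_right_real] by blast
  qed
  \<comment> \<open>With \<open>g v < \<gamma> * \<eta>\<close>, the bound
    \<open>\<delta> / \<gamma>\<close> makes linear growth available, and the two bounds containing
    \<open>c\<close> then put \<open>v\<close> within \<open>r / 2\<close> and \<open>\<rho>\<close>
    of \<open>ybar\<close>. The Ekeland point will satisfy \<open>dist x' xbar < 2 * \<eta>\<close>,
    so \<open>\<rho> / 2\<close> keeps it in the range of the slope infimum. The bounds
    \<open>r / 3\<close> and \<open>\<rho> * r / 2\<close> keep graph points outside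
    \<open>U\<close> at weighted distance at least \<open>\<eta>\<close> from it.\<close>
  define \<eta> where "\<eta> = Min {\<delta> / \<gamma>, r / 3, c * r / (2 * \<gamma>), \<rho> / 2, c * \<rho> / \<gamma>, \<rho> * r / 2}"
  have "0 < \<eta>"
    using \<open>0 < \<gamma>\<close> \<open>0 < \<delta>\<close> \<open>0 < r\<close> \<open>0 < c\<close> \<open>0 < \<rho>\<close> by (simp add: \<eta>_def)
  have \<eta>_le: "\<eta> \<le> \<delta> / \<gamma>" "\<eta> \<le> r / 3" "\<eta> \<le> c * r / (2 * \<gamma>)" "\<eta> \<le> \<rho> / 2" "\<eta> \<le> c * \<rho> / \<gamma>"
    "\<eta> \<le> \<rho> * r / 2"
    unfolding \<eta>_def by (intro Min_le; simp)+
  have near: "dist v ybar < r / 2" "dist v ybar < \<rho>" if "g v < \<gamma> * \<eta>" for v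
  proof -
    have "g v < \<delta>"
      using that \<eta>_le(1) \<open>0 < \<gamma>\<close> by (simp add: field_simps)
    then have *: "c * dist v ybar < \<gamma> * \<eta>"
      using c that by fastforce
    also have "\<gamma> * \<eta> \<le> c * (r / 2)"
      using \<eta>_le(3) \<open>0 < \<gamma>\<close> by (simp add: field_simps)
    finally show "dist v ybar < r / 2"
      using \<open>0 < c\<close> by (simp only: mult_less_cancel_left_pos)
    note *
    also have "\<gamma> * \<eta> \<le> c * \<rho>"
      using \<eta>_le(5) \<open>0 < \<gamma>\<close> by (simp add: field_simps)
    finally show "dist v ybar < \<rho>"
      using \<open>0 < c\<close> by (simp only: mult_less_cancel_left_pos)
  qed
  obtain x y where xy: "dist x xbar < \<eta>" "x \<notin> set_inverse F ybar" "y \<in> F x"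
    "g y < \<gamma> * infdist x (set_inverse F ybar)"
    using subreg_modulus_lessD[of ybar g F xbar \<gamma> \<eta>] pos sub \<open>0 < \<eta>\<close> by blast
  \<comment> \<open>As \<open>xbar\<close> lies in the inverse image, the distance from
    \<open>x\<close> to it is below \<open>\<eta>\<close>; this makes \<open>g y\<close> small and
    so puts \<open>y\<close> near \<open>ybar\<close>.\<close>
  have infdist_le: "infdist x (set_inverse F ybar) \<le> dist x xbar"
    using gph by (intro infdist_le) (simp add: set_inverse_def gph_def)
  have "g y < \<gamma> * \<eta>"
    using xy(4) mult_left_mono[of "infdist x (set_inverse F ybar)" \<eta> \<gamma>] infdist_le xy(1) \<open>0 < \<gamma>\<close>
    by linarith
  define A where "A = gph F \<inter> U"
  have "(x, y) \<in> A"
    using xy near(1)[OF \<open>g y < \<gamma> * \<eta>\<close>] \<eta>_le(2) \<open>0 < r\<close> r[of x y] by (auto simp: A_def gph_def)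
  interpret Metric_space A "dist_rho \<rho>"
    by (rule Metric_space_dist_rho) fact
  have mcomplete: "mcomplete"
    using \<open>0 < \<rho>\<close> U(2) complete unfolding A_def by (rule mcomplete_dist_rho)
  have "continuous_on UNIV (\<lambda>p::'x \<times> 'y. g (snd p))"
    by (intro continuous_on_compose2[OF cont] continuous_intros) auto
  then have lsc: "closedin mtopology {p \<in> A. g (snd p) \<le> a}" for a
    using \<open>0 < \<rho>\<close> by (intro closedin_sublevel_dist_rho)
  obtain q where "q \<in> A"
    and q_le: "g (snd q) + \<gamma> * dist_rho \<rho> q (x, y) \<le> g (snd (x, y))"
    and q_min: "\<And>p. p \<in> A \<Longrightarrow> p \<noteq> q \<Longrightarrow> g (snd q) < g (snd p) + \<gamma> * dist_rho \<rho> p q"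
    using ekeland_variational_principle[where f = "\<lambda>p. g (snd p)",
        OF mcomplete lsc g_nonneg \<open>(x, y) \<in> A\<close> \<open>0 < \<gamma>\<close>]
    by blast
  obtain x' y' where q: "q = (x', y')" by (cases q)
  have "g y' \<le> g y"
    using q_le mult_nonneg_nonneg[OF less_imp_le[OF \<open>0 < \<gamma>\<close>] nonneg, of q "(x, y)"]
    unfolding q snd_conv by linarith
  then have "g y' < \<gamma> * \<eta>"
    using \<open>g y < \<gamma> * \<eta>\<close> by simp
  have "\<gamma> * dist x' x \<le> \<gamma> * dist_rho \<rho> q (x, y)"
    using \<open>0 < \<gamma>\<close> by (simp add: q dist_rho_def)
  \<comment> \<open>Nonnegativity of \<open>g\<close> turns the Ekeland estimate into a bound by
    \<open>g y\<close> alone.\<close>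
  also have "\<dots> < \<gamma> * infdist x (set_inverse F ybar)"
    using q_le xy(4) g_nonneg[of y'] by (simp add: q)
  finally have x'_x: "dist x' x < infdist x (set_inverse F ybar)"
    using \<open>0 < \<gamma>\<close> by simp
  \<comment> \<open>The point \<open>x'\<close> is closer to \<open>x\<close> than the inverse image
    is.\<close>
  have x': "x' \<notin> set_inverse F ybar"
    using x'_x Elementary_Metric_Spaces.infdist_le[of x' "set_inverse F ybar" x]
    by (auto simp: dist_commute)
  have "dist x' xbar < 2 * \<eta>"
    using dist_triangle[of x' xbar x] x'_x infdist_le xy(1) by linarith
  have "strict_slope_inf g F xbar ybar \<rho> \<le> nonlocal_slope g \<rho> F x' y'"
    unfolding strict_slope_inf_def
    by (rule INF_lower2[of "(x', y')"])
      (use \<open>q \<in> A\<close> \<open>dist x' xbar < 2 * \<eta>\<close> \<eta>_le(4) near(2)[OF \<open>g y' < \<gamma> * \<eta>\<close>] x' in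
        \<open>auto simp: A_def q\<close>)
  also have "\<dots> \<le> ennreal \<gamma>"
  proof (rule nonlocal_slope_leI[OF \<open>0 < \<rho>\<close> \<open>0 < \<gamma>\<close>])
    fix u v assume uv: "(u, v) \<in> gph F" "(u, v) \<noteq> (x', y')"
    show "g y' - g v \<le> \<gamma> * dist_rho \<rho> (u, v) (x', y')"
    \<comment> \<open>Ekeland minimality covers only graph points in \<open>U\<close>. Any other one
      is at weighted distance at least \<open>\<eta>\<close> from \<open>(x', y')\<close>, and
      \<open>g y' < \<gamma> * \<eta>\<close> already suffices.\<close>
    proof (cases "(u, v) \<in> U")
      case True
      then show ?thesis
        using q_min[of "(u, v)"] uv by (simp add: A_def q)
    next
      case False
      then consider "r \<le> dist u xbar" | "r \<le> dist v ybar"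
        using r not_le by blast
      then have "\<eta> \<le> dist_rho \<rho> (u, v) (x', y')"
      proof cases
        case 1
        then have "\<eta> \<le> dist u x'"
          using dist_triangle[of u xbar x'] \<open>dist x' xbar < 2 * \<eta>\<close> \<eta>_le(2) by linarith
        then show ?thesis by (simp add: dist_rho_def)
      next
        case 2
        then have "r / 2 \<le> dist v y'"
          using dist_triangle[of v ybar y'] near(1)[OF \<open>g y' < \<gamma> * \<eta>\<close>] by linarith
        then have "\<rho> * (r / 2) \<le> \<rho> * dist v y'"
          using \<open>0 < \<rho>\<close> by simp
        then show ?thesis
          using \<eta>_le(6) by (simp add: dist_rho_def)
      qed
      then have "\<gamma> * \<eta> \<le> \<gamma> * dist_rho \<rho> (u, v) (x', y')"
        using \<open>0 < \<gamma>\<close> by simp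
      then show ?thesis
        using \<open>g y' < \<gamma> * \<eta>\<close> g_nonneg[of v] by linarith
    qed
  qed
  finally show False
    using \<rho> by simp
qed

theorem theorem4p1:
  fixes F :: "'x::metric_space \<Rightarrow> 'y::metric_space set"
    and g :: "'y \<Rightarrow> real"
    and xbar :: 'x and ybar :: 'y
  assumes "(xbar, ybar) \<in> gph F"
    and "\<And>y. g y \<ge> 0"
    and "g ybar = 0"
    and "isCont g ybar"
    and "locally_lipschitz_on (UNIV - {ybar}) g"
    and "\<And>y. y \<noteq> ybar \<Longrightarrow> g y > 0"
    and "Liminf (filtercomap g (at_right 0)) (\<lambda>y. ennreal (g y) / ennreal (dist y ybar)) > 0"
  shows "subreg_modulus g F xbar ybar \<le> strict_slope g F xbar ybar \<and>
    (complete (UNIV :: 'x set) \<longrightarrow> complete (UNIV :: 'y set) \<longrightarrow>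
       locally_closed_near (gph F) (xbar, ybar) \<longrightarrow>
       subreg_modulus g F xbar ybar = strict_slope g F xbar ybar)"
proof -
  \<comment> \<open>Away from \<open>ybar\<close>, continuity comes from the local Lipschitz
    property, since the complement of a point is open.\<close>
  have "continuous_on UNIV g"
  proof -
    have "isCont g y" if "y \<noteq> ybar" for y
    proof -
      have "continuous_on (UNIV - {ybar}) g"
        by (rule locally_lipschitz_on_imp_continuous_on) fact
      then show ?thesis
        using that by (simp add: continuous_on_eq_continuous_at open_Diff)
    qed
    then show ?thesis
      using assms(4) unfolding continuous_on_eq_continuous_at[OF open_UNIV] by metis
  qed
  then show ?thesis
    using subreg_modulus_le_strict_slope[of xbar ybar F g]
      strict_slope_le_subreg_modulus[of xbar ybar F g] assms
    by (blast intro: antisym)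
qed

end
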